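(* Let $d,n\ge 1$ be integers and let $X=(X_1,\dots,X_d)$ be a random vector with independent components, where $X_j$ has law $\mu_j$, a Borel probability measure absolutely continuous with respect to Lebesgue measure, with continuous density $\rho_j$ taking strictly positive values on its open support $\Omega_j\subseteq\mathbb R$, and cumulative distribution function $F_j$. Put $\Omega=\Omega_1\times\dots\times\Omega_d$ and $\mu=\mu_1\otimes\dots\otimes\mu_d$. Let $f:\mathbb R^d\to\mathbb R^n$ be a function each of whose components is Borel measurable and differentiable with respect to $x_v$ for every $v\subseteq\{1,\dots,d\}$, with $\mathbb E\|f(X)\|^2<+\infty$, and such that for every $v\subseteq\{1,\dots,d\}$ the function $\frac{\partial^{|v|}f}{\partial x_v}$ is measurable with $\mathbb E\left\|\frac{\partial^{|v|}f}{\partial x_v}(X)\right\|^2<+\infty$. Let $u\subseteq\{1,\dots,d\}$ be nonempty, let $X_1,\dots,X_m$ be a sample of size $m$ from $X$, with $X_{i,k}$ the $k$-th coordinate of $X_i$, let $\Sigma=\mathrm{Var}_\mu(f)$, and let $\widehat\Sigma$ be the classical (sample covariance) estimator of $\Sigma$. Put $$NUB_u^{sup}=\frac1{2^{|u|}}\int_\Omega\frac{\partial^{|u|}f}{\partial x_u}(x)\frac{\partial^{|u|}f^{T}}{\partial x_u}(x)\prod_{k\in u}\frac{F_k(x_k)(1-F_k(x_k))}{[\rho_k(x_k)]^2}\,d\mu(x),$$ $$M_m=\frac1{2^{|u|}m}\sum_{i=1}^m\frac{\partial^{|u|}f}{\partial x_u}(X_i)\frac{\partial^{|u|}f^{T}}{\partial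 x_u}(X_i)\prod_{k\in u}\frac{F_k(X_{i,k})(1-F_k(X_{i,k}))}{[\rho_k(X_{i,k})]^2}.$$ Then: (i) The first-type proxy-measure $\widehat{UB_u^F}:=\dfrac{\mathrm{Tr}(M_m)}{\mathrm{Tr}(\widehat\Sigma)}$ of the total-interaction generalized sensitivity index of $X_u$ satisfies, as $m\to+\infty$, $\widehat{UB_u^F}\to\dfrac{\mathrm{Tr}(NUB_u^{sup})}{\mathrm{Tr}(\Sigma)}$ in probability. (ii) The second-type proxy-measure $\widehat{UB_u^{l_2}}:=\dfrac{\|M_m\|_F}{n\,\mathrm{Tr}(\widehat\Sigma)}$ of the total-interaction generalized sensitivity index of $X_u$ satisfies, as $m\to+\infty$, $\widehat{UB_u^{l_2}}\to\dfrac{\|NUB_u^{sup}\|_F}{n\,\mathrm{Tr}(\Sigma)}$ in probability.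
   Context: For $v\subseteq\{1,\dots,d\}$: $x_v=(x_j)_{j\in v}$; $\frac{\partial^{|v|}}{\partial x_v}:=\prod_{j\in v}\frac{\partial}{\partial x_j}$ is the cross-partial derivative (once in each $x_j$, $j\in v$), applied to each component of $f$; $f$ is "differentiable with respect to $x_v$" if it exists. $\mathrm{Tr}$ is the trace and $\|\Sigma\|_F=\sqrt{\mathrm{Tr}(\Sigma\Sigma^{T})}$ the Frobenius norm. Vectors in $\mathbb R^n$ are columns, $T$ is transpose, $\|\cdot\|$ is the Euclidean norm, $\mathrm{Var}_\mu(g)=\int_\Omega gg^{T}d\mu-\int_\Omega g\,d\mu\int_\Omega g^{T}d\mu$. A sample from $X$ means independent copies of $X$; $\widehat\Sigma$ is computed from a sample whose size grows with $m$ (e.g. from $f(X_1),\dots,f(X_m)$). The word "proxy-measure of the total-interaction generalized sensitivity index" is only a name for the displayed quantities. *)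

theory Defs
  imports "HOL-Probability.Probability"
begin

section \<open>Cross-partial derivatives\<close>

definition partial_deriv :: "'d \<Rightarrow> (real^'d \<Rightarrow> real) \<Rightarrow> real^'d \<Rightarrow> real" where
  "partial_deriv j g x = deriv (\<lambda>t. g (x + t *\<^sub>R axis j 1)) 0"

definition partially_differentiable :: "'d \<Rightarrow> (real^'d \<Rightarrow> real) \<Rightarrow> bool" where
  "partially_differentiable j g \<longleftrightarrow>
     (\<forall>x. (\<lambda>t. g (x + t *\<^sub>R axis j 1)) field_differentiable (at 0))"

text \<open>Along the list \<open>[j\<^sub>1, \<dots>, j\<^sub>r]\<close> the iterated derivative is
  \<open>\<partial>/\<partial>x\<^bsub>j\<^sub>1\<^esub> \<dots> \<partial>/\<partial>x\<^bsub>j\<^sub>r\<^esub> g\<close>, the last entry being differentiated first.\<close>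

definition iterated_partial :: "'d list \<Rightarrow> (real^'d \<Rightarrow> real) \<Rightarrow> real^'d \<Rightarrow> real" where
  "iterated_partial js g = foldr partial_deriv js g"

primrec iterated_differentiable :: "'d list \<Rightarrow> (real^'d \<Rightarrow> real) \<Rightarrow> bool" where
  "iterated_differentiable [] g \<longleftrightarrow> True"
| "iterated_differentiable (j # js) g \<longleftrightarrow>
     iterated_differentiable js g \<and> partially_differentiable j (iterated_partial js g)"

text \<open>The product of the \<open>\<partial>/\<partial>x\<^sub>j\<close>, \<open>j \<in> v\<close>, is read in the order of the indices, and is
  applied to every component. No equality of the mixed partials taken in other orders is required.
  The linear order on the finite index type \<open>'d\<close> is that of \<open>{1, \<dots>, d}\<close>.\<close>

definition cross_partial ::
  "'d::{finite,linorder} set \<Rightarrow> ((real, 'd) vec \<Rightarrow> real^'n) \<Rightarrow> (real, 'd) vec \<Rightarrow> real^'n" where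
  "cross_partial v f x = (\<chi> i. iterated_partial (sorted_list_of_set v) (\<lambda>y. f y $ i) x)"

definition differentiable_wrt ::
  "'d::{finite,linorder} set \<Rightarrow> ((real, 'd) vec \<Rightarrow> real^'n) \<Rightarrow> bool" where
  "differentiable_wrt v f \<longleftrightarrow>
     (\<forall>i. iterated_differentiable (sorted_list_of_set v) (\<lambda>y. f y $ i))"


section \<open>Matrices\<close>

definition outer :: "real^'n \<Rightarrow> real^'n \<Rightarrow> real^'n^'n" where
  "outer v w = (columnvector v :: real^1^'n) ** rowvector w"

definition frobenius_norm :: "real^'n^'n \<Rightarrow> real" where
  "frobenius_norm A = sqrt (trace (A ** transpose A))"


section \<open>Probability\<close>

definition product_law :: "('d \<Rightarrow> real measure) \<Rightarrow> (real^'d) measure" where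
  "product_law \<mu> = distr (\<Pi>\<^sub>M j\<in>UNIV. \<mu> j) borel (\<lambda>x. \<chi> j. x j)"

definition box_of :: "('d \<Rightarrow> real set) \<Rightarrow> (real^'d) set" where
  "box_of \<Omega> = {x. \<forall>j. x $ j \<in> \<Omega> j}"

definition variance_matrix ::
  "(real^'d) measure \<Rightarrow> (real^'d) set \<Rightarrow> (real^'d \<Rightarrow> real^'n) \<Rightarrow> real^'n^'n" where
  "variance_matrix M D g =
     (LINT x:D|M. outer (g x) (g x)) - outer (LINT x:D|M. g x) (LINT x:D|M. g x)"

text \<open>A sample \<open>S 1, S 2, \<dots>\<close> from \<open>X\<close>; the index \<open>0\<close> is not used.\<close>

definition iid_sample :: "'w measure \<Rightarrow> ('w \<Rightarrow> real^'d) \<Rightarrow> (nat \<Rightarrow> 'w \<Rightarrow> real^'d) \<Rightarrow> bool" where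
  "iid_sample P X S \<longleftrightarrow>
     prob_space.indep_vars P (\<lambda>_. borel) S {1..} \<and>
     (\<forall>i\<ge>1. distr P borel (S i) = distr P borel X)"

definition sample_mean :: "nat \<Rightarrow> (nat \<Rightarrow> real^'n) \<Rightarrow> real^'n" where
  "sample_mean m y = (1 / real m) *\<^sub>R (\<Sum>i=1..m. y i)"

definition sample_covariance :: "nat \<Rightarrow> (nat \<Rightarrow> real^'n) \<Rightarrow> real^'n^'n" where
  "sample_covariance m y =
     (1 / (real m - 1)) *\<^sub>R (\<Sum>i=1..m. outer (y i - sample_mean m y) (y i - sample_mean m y))"

definition tendsto_in_prob :: "'w measure \<Rightarrow> (nat \<Rightarrow> 'w \<Rightarrow> real) \<Rightarrow> real \<Rightarrow> bool" where
  "tendsto_in_prob P Z c \<longleftrightarrow>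
     (\<forall>\<epsilon>>0. (\<lambda>m. measure P {\<omega> \<in> space P. \<bar>Z m \<omega> - c\<bar> > \<epsilon>}) \<longlonglongrightarrow> 0)"

definition tendsto_infinity_in_prob :: "'w measure \<Rightarrow> (nat \<Rightarrow> 'w \<Rightarrow> real) \<Rightarrow> bool" where
  "tendsto_infinity_in_prob P Z \<longleftrightarrow>
     (\<forall>K. (\<lambda>m. measure P {\<omega> \<in> space P. Z m \<omega> \<le> K}) \<longlonglongrightarrow> 0)"


section \<open>The upper bound and its estimator\<close>

definition NUB_integrand ::
  "('d::{finite,linorder} \<Rightarrow> real measure) \<Rightarrow> ('d \<Rightarrow> real \<Rightarrow> real) \<Rightarrow> 'd set \<Rightarrow>
   ((real, 'd) vec \<Rightarrow> real^'n) \<Rightarrow> (real, 'd) vec \<Rightarrow> real^'n^'n" where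
  "NUB_integrand \<mu> \<rho> u f x =
     (\<Prod>k\<in>u. cdf (\<mu> k) (x $ k) * (1 - cdf (\<mu> k) (x $ k)) / (\<rho> k (x $ k))\<^sup>2)
     *\<^sub>R outer (cross_partial u f x) (cross_partial u f x)"

definition NUB_sup ::
  "('d::{finite,linorder} \<Rightarrow> real measure) \<Rightarrow> ('d \<Rightarrow> real \<Rightarrow> real) \<Rightarrow> ('d \<Rightarrow> real set) \<Rightarrow> 'd set \<Rightarrow>
   ((real, 'd) vec \<Rightarrow> real^'n) \<Rightarrow> real^'n^'n" where
  "NUB_sup \<mu> \<rho> \<Omega> u f =
     (1 / 2 ^ card u) *\<^sub>R (LINT x:box_of \<Omega>|product_law \<mu>. NUB_integrand \<mu> \<rho> u f x)"

text \<open>The second-moment assumptions on the derivatives do not make the integral defining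
  \<open>NUB_sup\<close> finite (for the standard normal law and \<open>f x = x\<close> it is infinite),
  so its existence is tracked separately; the Bochner integral is \<open>0\<close> when it fails.\<close>

definition NUB_finite ::
  "('d::{finite,linorder} \<Rightarrow> real measure) \<Rightarrow> ('d \<Rightarrow> real \<Rightarrow> real) \<Rightarrow> ('d \<Rightarrow> real set) \<Rightarrow> 'd set \<Rightarrow>
   ((real, 'd) vec \<Rightarrow> real^'n) \<Rightarrow> bool" where
  "NUB_finite \<mu> \<rho> \<Omega> u f \<longleftrightarrow>
     set_integrable (product_law \<mu>) (box_of \<Omega>) (NUB_integrand \<mu> \<rho> u f)"

definition NUB_estimator ::
  "('d::{finite,linorder} \<Rightarrow> real measure) \<Rightarrow> ('d \<Rightarrow> real \<Rightarrow> real) \<Rightarrow> 'd set \<Rightarrow>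
   ((real, 'd) vec \<Rightarrow> real^'n) \<Rightarrow> nat \<Rightarrow> (nat \<Rightarrow> (real, 'd) vec) \<Rightarrow> real^'n^'n" where
  "NUB_estimator \<mu> \<rho> u f m x =
     (1 / (2 ^ card u * real m)) *\<^sub>R (\<Sum>i=1..m. NUB_integrand \<mu> \<rho> u f (x i))"

text \<open>In the next two definitions \<open>C\<close> is the estimate of the covariance matrix.\<close>

definition UB_F_estimator ::
  "('d::{finite,linorder} \<Rightarrow> real measure) \<Rightarrow> ('d \<Rightarrow> real \<Rightarrow> real) \<Rightarrow> 'd set \<Rightarrow>
   ((real, 'd) vec \<Rightarrow> real^'n) \<Rightarrow> nat \<Rightarrow> (nat \<Rightarrow> (real, 'd) vec) \<Rightarrow> real^'n^'n \<Rightarrow> real" where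
  "UB_F_estimator \<mu> \<rho> u f m x C = trace (NUB_estimator \<mu> \<rho> u f m x) / trace C"

definition UB_l2_estimator ::
  "('d::{finite,linorder} \<Rightarrow> real measure) \<Rightarrow> ('d \<Rightarrow> real \<Rightarrow> real) \<Rightarrow> 'd set \<Rightarrow>
   ((real, 'd) vec \<Rightarrow> real^'n) \<Rightarrow> nat \<Rightarrow> (nat \<Rightarrow> (real, 'd) vec) \<Rightarrow> real^'n^'n \<Rightarrow> real" where
  "UB_l2_estimator \<mu> \<rho> u f m x C =
     frobenius_norm (NUB_estimator \<mu> \<rho> u f m x) / (real CARD('n) * trace C)"

end

theory Submission
  imports Defs
begin

text \<open>
  Both proxy-measures are continuous functions of two statistics: the matrix \<open>M\<^sub>m\<close>, which is the
  average of the independent copies \<open>G (S i)\<close> of the random matrix \<open>G (X)\<close> (with \<open>G\<close> the integrand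
  of \<open>NUB_sup\<close>, up to the factor \<open>1 / 2 ^ card u\<close>), and the trace of the sample covariance. The
  theorem is therefore a weak law of large numbers followed by the continuous mapping theorem.

  \<^item> The joint law of \<open>X\<close> is \<open>product_law \<mu>\<close> by independence (\<open>product_law_eq_distr\<close>), and \<open>X\<close> lies
    in the box \<open>\<Omega>\<close> almost surely, so that integrals over the box are expectations of functions of \<open>X\<close>.

  \<^item> Nothing beyond integrability of \<open>G (X)\<close> can be used for \<open>M\<^sub>m\<close>, since its entries need not
    have a finite variance. The weak law \<open>weak_law_of_large_numbers\<close> is thus proved under a first
    moment only, by truncation: the truncated averages converge by Chebyshev's inequality, and the
    remainders are small in mean, uniformly in the sample size.

  \<^item> When \<open>G (X)\<close> is not integrable, its trace, which equals its norm, is a nonnegative real variable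
    of infinite mean, and averages of such variables tend to infinity in probability
    (\<open>weak_law_infinite_mean\<close>), again by truncation. The Frobenius norm of \<open>M\<^sub>m\<close> dominates a
    multiple of its trace and so diverges too.

  \<^item> The trace of the sample covariance is \<open>m / (m - 1)\<close> times an average of squared norms minus
    the squared norm of an average. By the weak law it tends to
    \<open>E \<parallel>f (X)\<parallel>\<^sup>2 - \<parallel>E (f (X))\<parallel>\<^sup>2\<close>, the trace of \<open>\<Sigma>\<close>.

  Division is continuous at the limit unless the trace of \<open>\<Sigma>\<close> vanishes. In that degenerate case
  \<open>f (X)\<close> is almost surely constant, the sample covariance is almost surely \<open>0\<close>, and the estimators
  and their claimed limits are both \<open>0\<close>, the value of a division by \<open>0\<close>.
\<close>

section \<open>Convergence in probability along a filter\<close>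

text \<open>The limit is an arbitrary filter, so that \<open>nhds c\<close> gives convergence in probability to \<open>c\<close>,
  \<open>at_top\<close> gives divergence to infinity in probability, and the calculus of \<open>filterlim\<close> becomes
  a continuous mapping theorem for both at once. The exceptional event is covered by a measurable
  set of small measure instead of being measured itself, because the event that \<open>Q (h (Z m \<omega>))\<close>
  fails may be non-measurable for an arbitrary predicate \<open>Q\<close> or mapping \<open>h\<close>.\<close>
definition filterlim_in_prob :: "'w measure \<Rightarrow> (nat \<Rightarrow> 'w \<Rightarrow> 'b) \<Rightarrow> 'b filter \<Rightarrow> bool" where
  "filterlim_in_prob P Z F \<longleftrightarrow>
     (\<forall>Q. eventually Q F \<longrightarrow> (\<forall>\<delta>>0. \<forall>\<^sub>F m in sequentially.
        \<exists>A\<in>sets P. measure P A < \<delta> \<and> (\<forall>\<omega>\<in>space P - A. Q (Z m \<omega>))))"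

lemma filterlim_in_probI:
  assumes "\<And>Q \<delta>. eventually Q F \<Longrightarrow> \<delta> > 0 \<Longrightarrow>
    \<forall>\<^sub>F m in sequentially. \<exists>A\<in>sets P. measure P A < \<delta> \<and> (\<forall>\<omega>\<in>space P - A. Q (Z m \<omega>))"
  shows "filterlim_in_prob P Z F"
  using assms unfolding filterlim_in_prob_def by blast

lemma filterlim_in_probD:
  assumes "filterlim_in_prob P Z F" "eventually Q F" "\<delta> > 0"
  shows "\<forall>\<^sub>F m in sequentially. \<exists>A\<in>sets P. measure P A < \<delta> \<and> (\<forall>\<omega>\<in>space P - A. Q (Z m \<omega>))"
  using assms unfolding filterlim_in_prob_def by blast

text \<open>The continuous mapping theorem.\<close>
lemma filterlim_in_prob_compose:
  assumes "filterlim_in_prob P Z F" "filterlim h G F"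
  shows "filterlim_in_prob P (\<lambda>m \<omega>. h (Z m \<omega>)) G"
proof (rule filterlim_in_probI)
  fix Q and \<delta> :: real assume "eventually Q G" "\<delta> > 0"
  then show "\<forall>\<^sub>F m in sequentially. \<exists>A\<in>sets P. measure P A < \<delta> \<and>
      (\<forall>\<omega>\<in>space P - A. Q (h (Z m \<omega>)))"
    using filterlim_in_probD[OF assms(1), of "\<lambda>x. Q (h x)" \<delta>] assms(2)
    by (auto simp: filterlim_iff)
qed

lemma filterlim_in_prob_subseq:
  assumes "filterlim_in_prob P Z F" "filterlim N at_top sequentially"
  shows "filterlim_in_prob P (\<lambda>m. Z (N m)) F"
proof (rule filterlim_in_probI)
  fix Q and \<delta> :: real assume "eventually Q F" "\<delta> > 0"
  from filterlim_in_probD[OF assms(1) this] assms(2)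
  show "\<forall>\<^sub>F m in sequentially. \<exists>A\<in>sets P. measure P A < \<delta> \<and>
      (\<forall>\<omega>\<in>space P - A. Q (Z (N m) \<omega>))"
    unfolding filterlim_iff by blast
qed

lemma filterlim_in_prob_deterministic:
  assumes "filterlim c F sequentially"
  shows "filterlim_in_prob P (\<lambda>m \<omega>. c m) F"
proof (rule filterlim_in_probI)
  fix Q and \<delta> :: real assume "eventually Q F" "\<delta> > 0"
  then have "\<forall>\<^sub>F m in sequentially. Q (c m)" using assms by (auto simp: filterlim_iff)
  then show "\<forall>\<^sub>F m in sequentially. \<exists>A\<in>sets P. measure P A < \<delta> \<and> (\<forall>\<omega>\<in>space P - A. Q (c m))"
    by eventually_elim (use \<open>\<delta> > 0\<close> in \<open>auto intro!: bexI[of _ "{}"]\<close>)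
qed

lemma (in finite_measure) filterlim_in_prob_Pair:
  assumes "filterlim_in_prob M Y F" "filterlim_in_prob M Z G"
  shows "filterlim_in_prob M (\<lambda>m \<omega>. (Y m \<omega>, Z m \<omega>)) (F \<times>\<^sub>F G)"
proof (rule filterlim_in_probI)
  fix Q and \<delta> :: real assume "eventually Q (F \<times>\<^sub>F G)" and \<delta>: "\<delta> > 0"
  then obtain Qf Qg where Q: "eventually Qf F" "eventually Qg G"
    "\<And>x y. Qf x \<Longrightarrow> Qg y \<Longrightarrow> Q (x, y)"
    unfolding eventually_prod_filter by blast
  have \<delta>2: "\<delta> / 2 > 0" using \<delta> by simp
  from filterlim_in_probD[OF assms(1) Q(1) \<delta>2] filterlim_in_probD[OF assms(2) Q(2) \<delta>2]
  show "\<forall>\<^sub>F m in sequentially. \<exists>A\<in>sets M. measure M A < \<delta> \<and>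
      (\<forall>\<omega>\<in>space M - A. Q (Y m \<omega>, Z m \<omega>))"
  proof eventually_elim
    case (elim m)
    then obtain A B where A: "A \<in> sets M" "measure M A < \<delta> / 2" "\<forall>\<omega>\<in>space M - A. Qf (Y m \<omega>)"
      and B: "B \<in> sets M" "measure M B < \<delta> / 2" "\<forall>\<omega>\<in>space M - B. Qg (Z m \<omega>)"
      by blast
    have "measure M (A \<union> B) < \<delta>"
      using measure_subadditive[OF A(1) B(1)] A(2) B(2) by simp
    then show ?case using A B Q(3) by (intro bexI[of _ "A \<union> B"]) auto
  qed
qed

lemma (in finite_measure) tendsto_in_prob_compose2:
  assumes "filterlim_in_prob M Y (nhds a)" "filterlim_in_prob M Z (nhds b)"
    and "((\<lambda>x. h (fst x) (snd x)) \<longlongrightarrow> h a b) (nhds (a, b))"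
  shows "filterlim_in_prob M (\<lambda>m \<omega>. h (Y m \<omega>) (Z m \<omega>)) (nhds (h a b))"
  using filterlim_in_prob_compose[OF filterlim_in_prob_Pair[OF assms(1,2), folded nhds_prod] assms(3)]
  by simp

lemma tendsto_fst_nhds: "(fst \<longlongrightarrow> a) (nhds (a, b))"
  and tendsto_snd_nhds: "(snd \<longlongrightarrow> b) (nhds (a, b))"
  using tendsto_fst[OF filterlim_ident[of "nhds (a, b)"]] tendsto_snd[OF filterlim_ident[of "nhds (a, b)"]]
  by simp_all

lemma (in finite_measure) tendsto_in_prob_sum:
  fixes Z :: "'i \<Rightarrow> nat \<Rightarrow> 'a \<Rightarrow> 'b::topological_comm_monoid_add"
  assumes "finite I" "\<And>i. i \<in> I \<Longrightarrow> filterlim_in_prob M (Z i) (nhds (c i))"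
  shows "filterlim_in_prob M (\<lambda>m \<omega>. \<Sum>i\<in>I. Z i m \<omega>) (nhds (\<Sum>i\<in>I. c i))"
  using assms
proof (induction I rule: finite_induct)
  case empty
  then show ?case by (simp add: filterlim_in_prob_deterministic)
next
  case (insert i I)
  have "filterlim_in_prob M (\<lambda>m \<omega>. Z i m \<omega> + (\<Sum>i\<in>I. Z i m \<omega>)) (nhds (c i + (\<Sum>i\<in>I. c i)))"
    using insert
    by (intro tendsto_in_prob_compose2[where h = "(+)"] tendsto_add tendsto_fst_nhds tendsto_snd_nhds)
       auto
  then show ?case using insert by simp
qed

lemma filterlim_in_prob_at_top_mono:
  fixes Y Z :: "nat \<Rightarrow> 'w \<Rightarrow> real"
  assumes "filterlim_in_prob P Y at_top" "\<And>m \<omega>. \<omega> \<in> space P \<Longrightarrow> Y m \<omega> \<le> Z m \<omega>"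
  shows "filterlim_in_prob P Z at_top"
proof (rule filterlim_in_probI)
  fix Q :: "real \<Rightarrow> bool" and \<delta> :: real assume "eventually Q at_top" "\<delta> > 0"
  then obtain K where K: "\<And>x. x \<ge> K \<Longrightarrow> Q x" unfolding eventually_at_top_linorder by blast
  from filterlim_in_probD[OF assms(1) eventually_ge_at_top[of K] \<open>\<delta> > 0\<close>]
  show "\<forall>\<^sub>F m in sequentially. \<exists>A\<in>sets P. measure P A < \<delta> \<and> (\<forall>\<omega>\<in>space P - A. Q (Z m \<omega>))"
    by eventually_elim (meson DiffD1 K assms(2) order_trans)
qed

lemma AE_imp_filterlim_in_prob:
  assumes "\<And>m. AE \<omega> in P. Z m \<omega> = c"
  shows "filterlim_in_prob P Z (nhds c)"
proof (rule filterlim_in_probI)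
  fix Q and \<delta> :: real assume Q: "eventually Q (nhds c)" and \<delta>: "\<delta> > 0"
  show "\<forall>\<^sub>F m in sequentially. \<exists>A\<in>sets P. measure P A < \<delta> \<and> (\<forall>\<omega>\<in>space P - A. Q (Z m \<omega>))"
  proof (rule always_eventually, rule allI)
    fix m
    obtain A where A: "{\<omega> \<in> space P. \<not> Z m \<omega> = c} \<subseteq> A" "emeasure P A = 0" "A \<in> sets P"
      using AE_E[OF assms[of m]] .
    then show "\<exists>A\<in>sets P. measure P A < \<delta> \<and> (\<forall>\<omega>\<in>space P - A. Q (Z m \<omega>))"
      using \<delta> eventually_nhds_x_imp_x[OF Q]
      by (intro bexI[of _ A]) (auto simp: measure_def)
  qed
qed

text \<open>A set \<open>B m\<close> that is not measurable does no harm: the value of the measure on it is \<open>0\<close>.\<close>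
lemma (in finite_measure) measure_tendsto_0_if_covered:
  assumes "\<And>\<delta>. \<delta> > 0 \<Longrightarrow> \<forall>\<^sub>F m in sequentially. \<exists>A\<in>sets M. measure M A < \<delta> \<and> B m \<subseteq> A"
  shows "(\<lambda>m. measure M (B m)) \<longlonglongrightarrow> 0"
proof (rule tendstoI)
  fix \<delta> :: real assume "\<delta> > 0"
  from assms[OF this] show "\<forall>\<^sub>F m in sequentially. dist (measure M (B m)) 0 < \<delta>"
  proof eventually_elim
    case (elim m)
    then obtain A where A: "A \<in> sets M" "measure M A < \<delta>" "B m \<subseteq> A" by blast
    have "measure M (B m) \<le> measure M A"
      using A by (cases "B m \<in> sets M") (auto intro: finite_measure_mono simp: measure_notin_sets)
    then show ?case using A by simp
  qed
qed

lemma (in finite_measure) tendsto_in_prob_if_filterlim: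
  assumes "filterlim_in_prob M Z (nhds c)"
  shows "tendsto_in_prob M Z c"
  unfolding tendsto_in_prob_def
proof (intro allI impI measure_tendsto_0_if_covered)
  fix \<epsilon> \<delta> :: real assume "\<epsilon> > 0" "\<delta> > 0"
  have "eventually (\<lambda>y. dist y c < \<epsilon>) (nhds c)"
    using \<open>\<epsilon> > 0\<close> by (auto simp: eventually_nhds_metric)
  from filterlim_in_probD[OF assms this \<open>\<delta> > 0\<close>]
  show "\<forall>\<^sub>F m in sequentially. \<exists>A\<in>sets M. measure M A < \<delta> \<and> {\<omega> \<in> space M. \<epsilon> < \<bar>Z m \<omega> - c\<bar>} \<subseteq> A"
    by eventually_elim (force simp: dist_real_def)
qed

lemma (in finite_measure) tendsto_infinity_in_prob_if_filterlim:
  assumes "filterlim_in_prob M Z at_top"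
  shows "tendsto_infinity_in_prob M Z"
  unfolding tendsto_infinity_in_prob_def
proof (intro allI measure_tendsto_0_if_covered)
  fix K \<delta> :: real assume "\<delta> > 0"
  from filterlim_in_probD[OF assms eventually_gt_at_top[of K] this]
  show "\<forall>\<^sub>F m in sequentially. \<exists>A\<in>sets M. measure M A < \<delta> \<and> {\<omega> \<in> space M. Z m \<omega> \<le> K} \<subseteq> A"
    by eventually_elim force
qed

text \<open>A limit \<open>0\<close> of the denominators is admitted when they vanish almost surely: the quotients and
  \<open>a / 0\<close> are then all \<open>0\<close>. This covers a model output without variance.\<close>
lemma (in finite_measure) tendsto_in_prob_divide:
  fixes Y Z :: "nat \<Rightarrow> 'a \<Rightarrow> real"
  assumes Y: "filterlim_in_prob M Y (nhds a)" and Z: "filterlim_in_prob M Z (nhds b)"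
    and zero: "\<And>m. b = 0 \<Longrightarrow> AE \<omega> in M. Z m \<omega> = 0"
  shows "filterlim_in_prob M (\<lambda>m \<omega>. Y m \<omega> / Z m \<omega>) (nhds (a / b))"
proof (cases "b = 0")
  case True
  have "AE \<omega> in M. Y m \<omega> / Z m \<omega> = 0" for m
    using zero[OF True, of m] by eventually_elim simp
  with True show ?thesis by (simp add: AE_imp_filterlim_in_prob)
next
  case False
  then show ?thesis
    by (intro tendsto_in_prob_compose2[OF Y Z, where h = "(/)"] tendsto_divide
        tendsto_fst_nhds tendsto_snd_nhds)
qed

lemma (in finite_measure) filterlim_in_prob_divide_at_top:
  fixes Y Z :: "nat \<Rightarrow> 'a \<Rightarrow> real"
  assumes Y: "filterlim_in_prob M Y at_top" and Z: "filterlim_in_prob M Z (nhds b)" and b: "b > 0"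
  shows "filterlim_in_prob M (\<lambda>m \<omega>. Y m \<omega> / Z m \<omega>) at_top"
proof -
  have "filterlim (\<lambda>x. inverse (snd x) * fst x) at_top (at_top \<times>\<^sub>F nhds b)"
    using b
    by (intro filterlim_tendsto_pos_mult_at_top[where c = "inverse b"] tendsto_inverse
        filterlim_fst filterlim_snd) auto
  from filterlim_in_prob_compose[OF filterlim_in_prob_Pair[OF Y Z] this]
  show ?thesis by (simp add: field_simps)
qed

section \<open>Laws of large numbers\<close>

context prob_space
begin

lemma iid_sample_measurable:
  assumes "iid_sample M X S" "i \<ge> 1"
  shows "S i \<in> borel_measurable M"
  using assms unfolding iid_sample_def indep_vars_def by auto

lemma
  fixes g :: "real^'d \<Rightarrow> 'b::{banach, second_countable_topology}"
  assumes "iid_sample M X S" "i \<ge> 1" "X \<in> borel_measurable M" "g \<in> borel_measurable borel"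
  shows iid_sample_integrable_iff: "integrable M (\<lambda>\<omega>. g (S i \<omega>)) \<longleftrightarrow> integrable M (\<lambda>\<omega>. g (X \<omega>))"
    and iid_sample_expectation: "expectation (\<lambda>\<omega>. g (S i \<omega>)) = expectation (\<lambda>\<omega>. g (X \<omega>))"
proof -
  note [measurable] = assms(3,4) iid_sample_measurable[OF assms(1,2)]
  have D: "distr M borel (S i) = distr M borel X"
    using assms unfolding iid_sample_def by auto
  show "integrable M (\<lambda>\<omega>. g (S i \<omega>)) \<longleftrightarrow> integrable M (\<lambda>\<omega>. g (X \<omega>))"
    using integrable_distr_eq[of "S i" M borel g] integrable_distr_eq[of X M borel g] D by simp
  show "expectation (\<lambda>\<omega>. g (S i \<omega>)) = expectation (\<lambda>\<omega>. g (X \<omega>))"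
    using integral_distr[of "S i" M borel g] integral_distr[of X M borel g] D by simp
qed

lemma iid_sample_covariance_zero:
  fixes h :: "real^'d \<Rightarrow> real"
  assumes S: "iid_sample M X S" and X: "X \<in> borel_measurable M" and h: "h \<in> borel_measurable borel"
    and int: "integrable M (\<lambda>\<omega>. h (X \<omega>))" and zero: "expectation (\<lambda>\<omega>. h (X \<omega>)) = 0"
    and ij: "i \<ge> 1" "j \<ge> 1" "i \<noteq> j"
  shows "expectation (\<lambda>\<omega>. h (S i \<omega>) * h (S j \<omega>)) = 0"
proof -
  have "indep_vars (\<lambda>_. borel) S {i, j}"
    using S ij indep_vars_subset[of _ S "{1..}" "{i, j}"] unfolding iid_sample_def by auto
  then have "indep_vars (\<lambda>_. borel) (\<lambda>k \<omega>. h (S k \<omega>)) {i, j}"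
    by (rule indep_vars_compose2) (use h in auto)
  then have "expectation (\<lambda>\<omega>. \<Prod>k\<in>{i, j}. h (S k \<omega>)) = (\<Prod>k\<in>{i, j}. expectation (\<lambda>\<omega>. h (S k \<omega>)))"
    using S X h int ij by (intro indep_vars_lebesgue_integral) (auto simp: iid_sample_integrable_iff)
  then show ?thesis
    using ij iid_sample_expectation[OF S ij(1) X h] zero by simp
qed

text \<open>In the expansion of the square of the sum, only the \<open>m\<close> diagonal terms can have a nonzero
  expectation, and each of them is at most \<open>K\<^sup>2\<close>.\<close>
lemma sample_mean_second_moment_le:
  fixes h :: "real^'d \<Rightarrow> real"
  assumes S: "iid_sample M X S" and X: "X \<in> borel_measurable M" and h: "h \<in> borel_measurable borel"
    and bound: "\<And>x. \<bar>h x\<bar> \<le> K" and zero: "expectation (\<lambda>\<omega>. h (X \<omega>)) = 0"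
  shows "expectation (\<lambda>\<omega>. ((1 / real m) *\<^sub>R (\<Sum>i=1..m. h (S i \<omega>)))\<^sup>2) \<le> K\<^sup>2 / real m"
proof -
  have meas: "(\<lambda>\<omega>. h (S i \<omega>)) \<in> borel_measurable M" if "i \<in> {1..m}" for i
    using measurable_compose[OF iid_sample_measurable[OF S] h] that by simp
  have hh: "\<bar>h x * h y\<bar> \<le> K\<^sup>2" for x y
    using mult_mono[OF bound bound] bound[of x] by (auto simp: abs_mult power2_eq_square)
  have int: "integrable M (\<lambda>\<omega>. h (S i \<omega>) * h (S j \<omega>))" if "i \<in> {1..m}" "j \<in> {1..m}" for i j
    using meas[OF that(1)] meas[OF that(2)] hh
    by (intro integrable_const_bound[where B = "K\<^sup>2"]) auto
  have intX: "integrable M (\<lambda>\<omega>. h (X \<omega>))"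
    using measurable_compose[OF X h] bound by (intro integrable_const_bound[where B = K]) auto
  have "expectation (\<lambda>\<omega>. (\<Sum>i=1..m. h (S i \<omega>))\<^sup>2)
      = expectation (\<lambda>\<omega>. \<Sum>i=1..m. \<Sum>j=1..m. h (S i \<omega>) * h (S j \<omega>))"
    by (simp add: power2_eq_square sum_product)
  also have "\<dots> = (\<Sum>i=1..m. expectation (\<lambda>\<omega>. \<Sum>j=1..m. h (S i \<omega>) * h (S j \<omega>)))"
    by (intro Bochner_Integration.integral_sum Bochner_Integration.integrable_sum int)
  also have "\<dots> = (\<Sum>i=1..m. \<Sum>j=1..m. expectation (\<lambda>\<omega>. h (S i \<omega>) * h (S j \<omega>)))"
    by (intro sum.cong refl Bochner_Integration.integral_sum int)
  also have "\<dots> = (\<Sum>i=1..m. \<Sum>j=1..m. if j = i then expectation (\<lambda>\<omega>. h (S i \<omega>) * h (S i \<omega>)) else 0)"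
    using iid_sample_covariance_zero[OF S X h intX zero] by (intro sum.cong) auto
  also have "\<dots> = (\<Sum>i=1..m. expectation (\<lambda>\<omega>. h (S i \<omega>) * h (S i \<omega>)))"
    by (intro sum.cong) (auto simp: sum.delta)
  also have "\<dots> \<le> (\<Sum>i=1..m. K\<^sup>2)"
  proof (rule sum_mono)
    fix i assume "i \<in> {1..m}"
    then have "expectation (\<lambda>\<omega>. h (S i \<omega>) * h (S i \<omega>)) \<le> expectation (\<lambda>\<omega>. K\<^sup>2)"
      using int by (intro integral_mono order_trans[OF abs_ge_self hh]) auto
    then show "expectation (\<lambda>\<omega>. h (S i \<omega>) * h (S i \<omega>)) \<le> K\<^sup>2" by (simp add: prob_space)
  qed
  finally have "expectation (\<lambda>\<omega>. (\<Sum>i=1..m. h (S i \<omega>))\<^sup>2) \<le> real m * K\<^sup>2" by simp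
  then have "expectation (\<lambda>\<omega>. (\<Sum>i=1..m. h (S i \<omega>))\<^sup>2) / (real m)\<^sup>2 \<le> real m * K\<^sup>2 / (real m)\<^sup>2"
    by (rule divide_right_mono) simp
  then show ?thesis by (cases "m = 0") (simp_all add: power_divide power2_eq_square)
qed

lemma weak_law_bounded:
  fixes g :: "real^'d \<Rightarrow> real"
  assumes S: "iid_sample M X S" and X: "X \<in> borel_measurable M" and g: "g \<in> borel_measurable borel"
    and bound: "\<And>x. \<bar>g x\<bar> \<le> K"
  shows "filterlim_in_prob M (\<lambda>m \<omega>. (1 / real m) *\<^sub>R (\<Sum>i=1..m. g (S i \<omega>)))
           (nhds (expectation (\<lambda>\<omega>. g (X \<omega>))))"
proof (rule filterlim_in_probI)
  fix Q and \<delta> :: real assume Q: "eventually Q (nhds (expectation (\<lambda>\<omega>. g (X \<omega>))))" and \<delta>: "\<delta> > 0"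
  define c where "c = expectation (\<lambda>\<omega>. g (X \<omega>))"
  define h where "h x = g x - c" for x
  define B where "B = K + \<bar>c\<bar>"
  obtain \<epsilon> where \<epsilon>: "\<epsilon> > 0" "\<And>y. dist y c < \<epsilon> \<Longrightarrow> Q y"
    using Q unfolding eventually_nhds_metric c_def by blast
  have h_meas: "h \<in> borel_measurable borel" using g unfolding h_def by simp
  have h_bound: "\<bar>h x\<bar> \<le> B" for x using bound[of x] unfolding h_def B_def by linarith
  have "integrable M (\<lambda>\<omega>. g (X \<omega>))"
    using measurable_compose[OF X g] bound by (intro integrable_const_bound[where B = K]) auto
  then have h_zero: "expectation (\<lambda>\<omega>. h (X \<omega>)) = 0"
    unfolding h_def by (simp add: c_def prob_space)
  have hS[measurable]: "(\<lambda>\<omega>. h (S i \<omega>)) \<in> borel_measurable M" if "i \<ge> 1" for i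
    using measurable_compose[OF iid_sample_measurable[OF S that] h_meas] .
  have "(\<lambda>m. B\<^sup>2 / \<epsilon>\<^sup>2 / real m) \<longlonglongrightarrow> 0"
    by (intro tendsto_divide_0[OF tendsto_const] filterlim_at_top_imp_at_infinity filterlim_real_sequentially)
  then have "\<forall>\<^sub>F m in sequentially. B\<^sup>2 / \<epsilon>\<^sup>2 / real m < \<delta>"
    using \<delta> by (auto dest: order_tendstoD)
  then show "\<forall>\<^sub>F m in sequentially. \<exists>A\<in>sets M. measure M A < \<delta> \<and>
      (\<forall>\<omega>\<in>space M - A. Q ((1 / real m) *\<^sub>R (\<Sum>i=1..m. g (S i \<omega>))))"
    using eventually_ge_at_top[of 1]
  proof eventually_elim
    case (elim m)
    define Z where "Z \<omega> = (1 / real m) *\<^sub>R (\<Sum>i=1..m. h (S i \<omega>))" for \<omega>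
    define A where "A = {\<omega> \<in> space M. \<bar>Z \<omega>\<bar> \<ge> \<epsilon>}"
    have Z[measurable]: "Z \<in> borel_measurable M"
      unfolding Z_def by (intro borel_measurable_scaleR borel_measurable_sum) auto
    have Z_bound: "\<bar>Z \<omega>\<bar> \<le> B" for \<omega>
    proof -
      have "\<bar>\<Sum>i=1..m. h (S i \<omega>)\<bar> \<le> (\<Sum>i=1..m. B)"
        by (rule order_trans[OF sum_abs sum_mono]) (rule h_bound)
      then show ?thesis using elim unfolding Z_def by (simp add: field_simps abs_mult)
    qed
    have "integrable M (\<lambda>\<omega>. (Z \<omega>)\<^sup>2)"
      using Z_bound order_trans[OF abs_ge_zero Z_bound]
      by (intro integrable_const_bound[where B = "B\<^sup>2"]) (auto simp: abs_le_square_iff[symmetric] abs_le_iff)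
    then have "measure M A \<le> expectation (\<lambda>\<omega>. (Z \<omega>)\<^sup>2) / \<epsilon>\<^sup>2"
      unfolding A_def using \<epsilon> by (intro second_moment_method) auto
    also have "\<dots> \<le> (B\<^sup>2 / real m) / \<epsilon>\<^sup>2"
      unfolding Z_def
      by (intro divide_right_mono sample_mean_second_moment_le[OF S X h_meas h_bound h_zero]) simp
    also have "\<dots> < \<delta>" using elim by (simp add: field_simps)
    finally have "measure M A < \<delta>" .
    moreover have "Q ((1 / real m) *\<^sub>R (\<Sum>i=1..m. g (S i \<omega>)))" if "\<omega> \<in> space M - A" for \<omega>
    proof (rule \<epsilon>(2))
      have "Z \<omega> = (1 / real m) *\<^sub>R (\<Sum>i=1..m. g (S i \<omega>)) - c"
        using elim unfolding Z_def h_def by (simp add: sum_subtractf field_simps)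
      then show "dist ((1 / real m) *\<^sub>R (\<Sum>i=1..m. g (S i \<omega>))) c < \<epsilon>"
        using that unfolding A_def by (auto simp: dist_real_def)
    qed
    ultimately show ?case by (intro bexI[of _ A]) (auto simp: A_def)
  qed
qed

text \<open>With \<open>t k\<close> the function \<open>g\<close> cut off at level \<open>k\<close>, the deviation
  of the average of \<open>g\<close> from its mean has three parts: the deviation of the bounded \<open>t k\<close>, the
  difference of the two means, and the average of the remainder \<open>r k = \<bar>g - t k\<bar>\<close>. The last two are
  controlled by the expectation of \<open>r k\<close>, which does not depend on \<open>m\<close> and tends to \<open>0\<close> as \<open>k\<close> grows
  by dominated convergence.\<close>
lemma weak_law_real:
  fixes g :: "real^'d \<Rightarrow> real"
  assumes S: "iid_sample M X S" and X: "X \<in> borel_measurable M" and g: "g \<in> borel_measurable borel"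
    and int: "integrable M (\<lambda>\<omega>. g (X \<omega>))"
  shows "filterlim_in_prob M (\<lambda>m \<omega>. (1 / real m) *\<^sub>R (\<Sum>i=1..m. g (S i \<omega>)))
           (nhds (expectation (\<lambda>\<omega>. g (X \<omega>))))"
proof (rule filterlim_in_probI)
  fix Q and \<delta> :: real assume Q: "eventually Q (nhds (expectation (\<lambda>\<omega>. g (X \<omega>))))" and \<delta>: "\<delta> > 0"
  define c where "c = expectation (\<lambda>\<omega>. g (X \<omega>))"
  obtain \<epsilon> where \<epsilon>: "\<epsilon> > 0" "\<And>y. dist y c < \<epsilon> \<Longrightarrow> Q y"
    using Q unfolding eventually_nhds_metric c_def by blast
  define t where "t k x = (if \<bar>g x\<bar> \<le> real k then g x else 0)" for k x
  define r where "r k x = \<bar>g x - t k x\<bar>" for k x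
  note [measurable] = X g
  have t_meas[measurable]: "t k \<in> borel_measurable borel" for k unfolding t_def by measurable
  have r_meas[measurable]: "r k \<in> borel_measurable borel" for k unfolding r_def by measurable
  have r_le: "\<bar>r k x\<bar> \<le> \<bar>g x\<bar>" for k x unfolding r_def t_def by auto
  have r_int: "integrable M (\<lambda>\<omega>. r k (X \<omega>))" for k
    using r_le by (intro Bochner_Integration.integrable_bound[OF int]) auto
  have "(\<lambda>k. expectation (\<lambda>\<omega>. r k (X \<omega>))) \<longlonglongrightarrow> expectation (\<lambda>\<omega>. 0)"
  proof (rule integral_dominated_convergence[where w = "\<lambda>\<omega>. \<bar>g (X \<omega>)\<bar>"])
    have "(\<lambda>k. r k x) \<longlonglongrightarrow> 0" for x
    proof (rule tendsto_eventually)
      show "\<forall>\<^sub>F k in sequentially. r k x = 0"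
        using filterlim_at_top_dense[THEN iffD1, OF filterlim_real_sequentially, rule_format, of "\<bar>g x\<bar>"]
        by eventually_elim (simp add: r_def t_def)
    qed
    then show "AE \<omega> in M. (\<lambda>k. r k (X \<omega>)) \<longlonglongrightarrow> 0" by simp
  qed (use int r_le in auto)
  \<comment> \<open>The first bound makes the two means close. The second makes the average of the remainders
    exceed \<open>\<epsilon> / 3\<close> with probability less than \<open>\<delta> / 2\<close>, by Markov's inequality.\<close>
  moreover have "min (\<epsilon> / 3) (\<delta> * \<epsilon> / 6) > 0" using \<epsilon> \<delta> by simp
  ultimately have "\<forall>\<^sub>F k in sequentially. expectation (\<lambda>\<omega>. r k (X \<omega>)) < min (\<epsilon> / 3) (\<delta> * \<epsilon> / 6)"
    by (intro order_tendstoD(2)) auto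
  then obtain k where k: "expectation (\<lambda>\<omega>. r k (X \<omega>)) < min (\<epsilon> / 3) (\<delta> * \<epsilon> / 6)"
    using eventually_happens'[OF sequentially_bot] by blast
  define b where "b = expectation (\<lambda>\<omega>. t k (X \<omega>))"
  have t_bound: "\<bar>t k x\<bar> \<le> real k" for x unfolding t_def by auto
  have t_int: "integrable M (\<lambda>\<omega>. t k (X \<omega>))"
    using t_bound by (intro integrable_const_bound[where B = "real k"]) auto
  have "\<bar>c - b\<bar> = \<bar>expectation (\<lambda>\<omega>. g (X \<omega>) - t k (X \<omega>))\<bar>"
    using int t_int by (simp add: c_def b_def)
  also have "\<dots> \<le> expectation (\<lambda>\<omega>. r k (X \<omega>))"
    unfolding r_def by (rule integral_abs_bound)
  finally have bc: "\<bar>c - b\<bar> < \<epsilon> / 3" using k by simp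
  have "eventually (\<lambda>y. dist y b < \<epsilon> / 3) (nhds b)"
    using \<epsilon> by (metis eventually_nhds_metric divide_pos_pos zero_less_numeral)
  moreover have "\<delta> / 2 > 0" using \<delta> by simp
  ultimately have "\<forall>\<^sub>F m in sequentially. \<exists>A\<in>sets M. measure M A < \<delta> / 2 \<and>
      (\<forall>\<omega>\<in>space M - A. dist ((1 / real m) *\<^sub>R (\<Sum>i=1..m. t k (S i \<omega>))) b < \<epsilon> / 3)"
    unfolding b_def by (rule filterlim_in_probD[OF weak_law_bounded[OF S X t_meas t_bound]])
  then show "\<forall>\<^sub>F m in sequentially. \<exists>A\<in>sets M. measure M A < \<delta> \<and>
      (\<forall>\<omega>\<in>space M - A. Q ((1 / real m) *\<^sub>R (\<Sum>i=1..m. g (S i \<omega>))))"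
    using eventually_ge_at_top[of 1]
  proof eventually_elim
    case (elim m)
    then obtain A where A: "A \<in> sets M" "measure M A < \<delta> / 2"
      "\<And>\<omega>. \<omega> \<in> space M - A \<Longrightarrow> dist ((1 / real m) *\<^sub>R (\<Sum>i=1..m. t k (S i \<omega>))) b < \<epsilon> / 3" by blast
    define R where "R \<omega> = (1 / real m) *\<^sub>R (\<Sum>i=1..m. r k (S i \<omega>))" for \<omega>
    define B where "B = {\<omega> \<in> space M. R \<omega> \<ge> \<epsilon> / 3}"
    have rS: "integrable M (\<lambda>\<omega>. r k (S i \<omega>))"
      "expectation (\<lambda>\<omega>. r k (S i \<omega>)) = expectation (\<lambda>\<omega>. r k (X \<omega>))" if "i \<in> {1..m}" for i
      using iid_sample_integrable_iff[OF S _ X r_meas] iid_sample_expectation[OF S _ X r_meas] r_int that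
      by auto
    have R_int: "integrable M R" unfolding R_def using rS
      by (intro integrable_scaleR_right Bochner_Integration.integrable_sum) auto
    have "expectation R = (1 / real m) * (\<Sum>i=1..m. expectation (\<lambda>\<omega>. r k (S i \<omega>)))"
      unfolding R_def using rS by (simp add: Bochner_Integration.integral_sum)
    also have "\<dots> = expectation (\<lambda>\<omega>. r k (X \<omega>))" using rS elim by simp
    finally have R_exp: "expectation R = expectation (\<lambda>\<omega>. r k (X \<omega>))" .
    have "measure M B \<le> expectation R / (\<epsilon> / 3)"
      unfolding B_def using \<epsilon>
      by (intro integral_Markov_inequality_measure[where A = "{}"] R_int)
         (auto simp: R_def r_def intro!: sum_nonneg)
    also have "\<dots> < (\<delta> * \<epsilon> / 6) / (\<epsilon> / 3)"
      using k \<epsilon> by (intro divide_strict_right_mono) (auto simp: R_exp)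
    finally have B: "measure M B < \<delta> / 2" using \<epsilon> by (simp add: field_simps)
    have B_sets: "B \<in> sets M" unfolding B_def using borel_measurable_integrable[OF R_int] by measurable
    have "measure M (A \<union> B) < \<delta>"
      using measure_subadditive[OF A(1) B_sets] A(2) B by simp
    moreover have "Q ((1 / real m) *\<^sub>R (\<Sum>i=1..m. g (S i \<omega>)))" if \<omega>: "\<omega> \<in> space M - (A \<union> B)" for \<omega>
    proof (rule \<epsilon>(2))
      have "\<bar>(1 / real m) *\<^sub>R (\<Sum>i=1..m. g (S i \<omega>)) - (1 / real m) *\<^sub>R (\<Sum>i=1..m. t k (S i \<omega>))\<bar>
          = (1 / real m) * \<bar>\<Sum>i=1..m. g (S i \<omega>) - t k (S i \<omega>)\<bar>"
        by (simp add: sum_subtractf abs_mult flip: diff_divide_distrib)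
      also have "\<dots> \<le> R \<omega>"
        unfolding R_def r_def by (simp add: divide_right_mono sum_abs)
      also have "\<dots> < \<epsilon> / 3" using \<omega> unfolding B_def by auto
      finally have "dist ((1 / real m) *\<^sub>R (\<Sum>i=1..m. g (S i \<omega>)))
          ((1 / real m) *\<^sub>R (\<Sum>i=1..m. t k (S i \<omega>))) < \<epsilon> / 3"
        by (simp only: dist_real_def)
      moreover have "dist ((1 / real m) *\<^sub>R (\<Sum>i=1..m. t k (S i \<omega>))) b < \<epsilon> / 3"
        using A(3) \<omega> by blast
      ultimately show "dist ((1 / real m) *\<^sub>R (\<Sum>i=1..m. g (S i \<omega>))) c < \<epsilon>"
        using bc unfolding dist_real_def by linarith
    qed
    ultimately show ?case using A(1) B_sets by (intro bexI[of _ "A \<union> B"]) auto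
  qed
qed

theorem weak_law_of_large_numbers:
  fixes g :: "real^'d \<Rightarrow> 'b::euclidean_space"
  assumes S: "iid_sample M X S" and X: "X \<in> borel_measurable M" and g: "g \<in> borel_measurable borel"
    and int: "integrable M (\<lambda>\<omega>. g (X \<omega>))"
  shows "filterlim_in_prob M (\<lambda>m \<omega>. (1 / real m) *\<^sub>R (\<Sum>i=1..m. g (S i \<omega>)))
           (nhds (expectation (\<lambda>\<omega>. g (X \<omega>))))"
proof -
  let ?E = "expectation (\<lambda>\<omega>. g (X \<omega>))"
  let ?A = "\<lambda>m \<omega>. (1 / real m) *\<^sub>R (\<Sum>i=1..m. g (S i \<omega>))"
  have "filterlim_in_prob M (\<lambda>m \<omega>. (?A m \<omega> \<bullet> b) *\<^sub>R b) (nhds ((?E \<bullet> b) *\<^sub>R b))" for b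
  proof (rule filterlim_in_prob_compose[where h = "\<lambda>y. y *\<^sub>R b"])
    show "filterlim_in_prob M (\<lambda>m \<omega>. ?A m \<omega> \<bullet> b) (nhds (?E \<bullet> b))"
      using weak_law_real[OF S X, of "\<lambda>x. g x \<bullet> b"] g int
      by (simp add: inner_sum_left)
    show "((\<lambda>y. y *\<^sub>R b) \<longlongrightarrow> (?E \<bullet> b) *\<^sub>R b) (nhds (?E \<bullet> b))"
      by (intro tendsto_scaleR tendsto_const filterlim_ident)
  qed
  from tendsto_in_prob_sum[of Basis "\<lambda>b m \<omega>. (?A m \<omega> \<bullet> b) *\<^sub>R b", OF finite_Basis this] show ?thesis
    by (simp only: euclidean_representation)
qed

text \<open>The average of \<open>g\<close> dominates the averages of the truncations \<open>min g k\<close>, which obey the bounded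
  law. By monotone convergence the means of the truncations are unbounded: otherwise \<open>g\<close> would be
  integrable.\<close>
theorem weak_law_infinite_mean:
  fixes g :: "real^'d \<Rightarrow> real"
  assumes S: "iid_sample M X S" and X: "X \<in> borel_measurable M" and g: "g \<in> borel_measurable borel"
    and nonneg: "\<And>x. 0 \<le> g x" and nonint: "\<not> integrable M (\<lambda>\<omega>. g (X \<omega>))"
  shows "filterlim_in_prob M (\<lambda>m \<omega>. (1 / real m) *\<^sub>R (\<Sum>i=1..m. g (S i \<omega>))) at_top"
proof (rule filterlim_in_probI)
  fix Q :: "real \<Rightarrow> bool" and \<delta> :: real assume Q: "eventually Q at_top" and \<delta>: "\<delta> > 0"
  obtain K where K: "\<And>y. y \<ge> K \<Longrightarrow> Q y" using Q unfolding eventually_at_top_linorder by blast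
  define t where "t k x = min (g x) (real k)" for k x
  note [measurable] = X g
  have t_meas[measurable]: "t k \<in> borel_measurable borel" for k unfolding t_def by measurable
  have t_bound: "\<bar>t k x\<bar> \<le> real k" for k x using nonneg[of x] unfolding t_def by auto
  have t_int: "integrable M (\<lambda>\<omega>. t k (X \<omega>))" for k
    using t_bound by (intro integrable_const_bound[where B = "real k"]) auto
  have t_mono: "t k x \<le> t l x" if "k \<le> l" for k l x using that unfolding t_def by auto
  define e where "e k = expectation (\<lambda>\<omega>. t k (X \<omega>))" for k
  have "incseq e"
    unfolding e_def by (intro monoI integral_mono t_int t_mono)
  have "\<exists>k. e k > K"
  proof (rule ccontr)
    assume "\<not> (\<exists>k. e k > K)"
    then obtain L where L: "e \<longlonglongrightarrow> L"
      using incseq_convergent[OF \<open>incseq e\<close>, of K] by (force simp: not_less)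
    have "(\<lambda>k. t k x) \<longlonglongrightarrow> g x" for x
    proof (rule tendsto_eventually)
      show "\<forall>\<^sub>F k in sequentially. t k x = g x"
        using filterlim_at_top_dense[THEN iffD1, OF filterlim_real_sequentially, rule_format, of "g x"]
        by eventually_elim (simp add: t_def)
    qed
    then have "AE \<omega> in M. (\<lambda>k. t k (X \<omega>)) \<longlonglongrightarrow> g (X \<omega>)" by simp
    moreover have "AE \<omega> in M. mono (\<lambda>k. t k (X \<omega>))" by (intro AE_I2 monoI t_mono)
    ultimately have "integrable M (\<lambda>\<omega>. g (X \<omega>))"
      using L unfolding e_def
      by (intro integrable_monotone_convergence[where f = "\<lambda>k \<omega>. t k (X \<omega>)", OF t_int]) measurable
    with nonint show False ..
  qed
  then obtain k where k: "e k > K" ..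
  have "eventually (\<lambda>y. y > K) (nhds (e k))"
    using k by (intro order_tendstoD[OF filterlim_ident])
  from filterlim_in_probD[OF weak_law_bounded[OF S X t_meas t_bound] this[unfolded e_def] \<delta>]
  show "\<forall>\<^sub>F m in sequentially. \<exists>A\<in>sets M. measure M A < \<delta> \<and>
      (\<forall>\<omega>\<in>space M - A. Q ((1 / real m) *\<^sub>R (\<Sum>i=1..m. g (S i \<omega>))))"
  proof eventually_elim
    case (elim m)
    have "(1 / real m) *\<^sub>R (\<Sum>i=1..m. t k (S i \<omega>)) \<le> (1 / real m) *\<^sub>R (\<Sum>i=1..m. g (S i \<omega>))" for \<omega>
      unfolding real_scaleR_def by (intro mult_left_mono sum_mono) (auto simp: t_def)
    with elim show ?case by (meson K less_imp_le order_trans)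
  qed
qed

end

section \<open>Trace and Frobenius norm\<close>

lemma outer_nth [simp]: "outer v w $ i $ j = v $ i * w $ j"
  by (simp add: outer_def matrix_matrix_mult_def columnvector_def rowvector_def)

lemma frobenius_norm_eq_norm: "frobenius_norm A = norm A"
  unfolding frobenius_norm_def norm_eq_sqrt_inner
  by (simp add: trace_def matrix_matrix_mult_def transpose_def inner_vec_def)

lemma norm_outer: "norm (outer v w) = norm v * norm w"
proof -
  have "(norm (outer v w))\<^sup>2 = (norm v * norm w)\<^sup>2"
    unfolding power_mult_distrib power2_norm_eq_inner
    by (simp add: inner_vec_def sum_product algebra_simps)
  then show ?thesis by (simp add: power2_eq_iff_nonneg)
qed

lemma trace_outer: "trace (outer v w) = v \<bullet> w"
  by (simp add: trace_def inner_vec_def)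

lemma bounded_linear_trace: "bounded_linear (trace :: real^'n^'n \<Rightarrow> real)"
  unfolding trace_def
  by (intro bounded_linear_sum bounded_linear_compose[OF bounded_linear_vec_nth bounded_linear_vec_nth])

lemma trace_scaleR: "trace (c *\<^sub>R A) = c * trace (A :: real^'n^'n)"
  by (simp add: linear_cmul[OF bounded_linear.linear[OF bounded_linear_trace]])

lemma trace_le_norm: "trace A \<le> real CARD('n) * norm (A :: real^'n^'n)"
proof -
  have "trace A \<le> (\<Sum>i\<in>(UNIV::'n set). norm A)"
    unfolding trace_def
  proof (rule sum_mono)
    fix i
    have "A $ i $ i \<le> norm (A $ i)"
      using component_le_norm_cart[of "A $ i" i] by simp
    also have "\<dots> \<le> norm A" by (rule Finite_Cartesian_Product.norm_nth_le)
    finally show "A $ i $ i \<le> norm A" .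
  qed
  then show ?thesis by simp
qed

lemma borel_measurable_vec_iff:
  fixes f :: "'a \<Rightarrow> 'b::euclidean_space^'n"
  shows "f \<in> borel_measurable M \<longleftrightarrow> (\<forall>i. (\<lambda>x. f x $ i) \<in> borel_measurable M)"
proof safe
  fix i assume "f \<in> borel_measurable M"
  moreover have "(\<lambda>x::'b^'n. x $ i) \<in> borel_measurable borel"
    by (intro borel_measurable_continuous_onI continuous_intros)
  ultimately show "(\<lambda>x. f x $ i) \<in> borel_measurable M" by (rule measurable_compose)
next
  assume "\<forall>i. (\<lambda>x. f x $ i) \<in> borel_measurable M"
  then show "f \<in> borel_measurable M"
    by (subst borel_measurable_euclidean_space)
       (auto simp: Basis_vec_def inner_axis intro!: borel_measurable_inner)
qed

lemma borel_measurable_outer: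
  assumes "v \<in> borel_measurable M" "w \<in> borel_measurable M"
  shows "(\<lambda>x. outer (v x) (w x)) \<in> borel_measurable M"
  using assms by (auto simp: borel_measurable_vec_iff intro!: borel_measurable_times)

text \<open>The familiar formula for the sum of squared deviations; it expresses the trace through averages
  to which the weak law applies. It also holds for \<open>m = 1\<close>, where both sides are \<open>0\<close> because
  \<open>1 / 0 = 0\<close>.\<close>
lemma trace_sample_covariance:
  "trace (sample_covariance m y) = (real m / (real m - 1)) *
     ((1 / real m) *\<^sub>R (\<Sum>i=1..m. (norm (y i))\<^sup>2) - (norm (sample_mean m y))\<^sup>2)"
proof (cases "m = 0")
  case True
  then show ?thesis
    by (simp add: sample_covariance_def trace_scaleR linear_0[OF bounded_linear.linear[OF bounded_linear_trace]])
next
  case False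
  let ?b = "sample_mean m y"
  have b: "(\<Sum>i=1..m. y i) = real m *\<^sub>R ?b" using False by (simp add: sample_mean_def)
  have "(norm (y i - ?b))\<^sup>2 = (norm (y i))\<^sup>2 - 2 * (y i \<bullet> ?b) + (norm ?b)\<^sup>2" for i
    by (simp add: power2_norm_eq_inner inner_diff inner_commute)
  then have "(\<Sum>i=1..m. (norm (y i - ?b))\<^sup>2)
      = (\<Sum>i=1..m. (norm (y i))\<^sup>2) - 2 * ((\<Sum>i=1..m. y i) \<bullet> ?b) + real m * (norm ?b)\<^sup>2"
    by (simp add: sum.distrib sum_subtractf inner_sum_left flip: sum_distrib_left)
  also have "\<dots> = (\<Sum>i=1..m. (norm (y i))\<^sup>2) - real m * (norm ?b)\<^sup>2"
    unfolding b by (simp add: power2_norm_eq_inner)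
  finally have *: "(\<Sum>i=1..m. (norm (y i - ?b))\<^sup>2) = (\<Sum>i=1..m. (norm (y i))\<^sup>2) - real m * (norm ?b)\<^sup>2" .
  have "trace (sample_covariance m y) = (1 / (real m - 1)) * (\<Sum>i=1..m. (norm (y i - ?b))\<^sup>2)"
    unfolding sample_covariance_def
    by (simp add: trace_scaleR linear_sum[OF bounded_linear.linear[OF bounded_linear_trace]]
        trace_outer power2_norm_eq_inner)
  also have "\<dots> = (real m / (real m - 1)) * ((1 / real m) *\<^sub>R (\<Sum>i=1..m. (norm (y i))\<^sup>2) - (norm ?b)\<^sup>2)"
    unfolding * using False by (simp add: right_diff_distrib)
  finally show ?thesis .
qed

section \<open>The law of the input vector\<close>

lemma (in prob_space) product_law_eq_distr:
  fixes X :: "'a \<Rightarrow> real^'d"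
  assumes indep: "indep_vars (\<lambda>_. borel) (\<lambda>j \<omega>. X \<omega> $ j) UNIV"
    and law: "\<And>j. distr M borel (\<lambda>\<omega>. X \<omega> $ j) = \<mu> j"
  shows "product_law \<mu> = distr M borel X"
proof -
  have rv: "(\<lambda>\<omega>. X \<omega> $ j) \<in> borel_measurable M" for j
    using indep unfolding indep_vars_def by auto
  have "distr M (\<Pi>\<^sub>M j\<in>UNIV. borel) (\<lambda>\<omega>. \<lambda>j\<in>UNIV. X \<omega> $ j) = (\<Pi>\<^sub>M j\<in>UNIV. \<mu> j)"
    using indep_vars_iff_distr_eq_PiM'[of UNIV "\<lambda>j \<omega>. X \<omega> $ j" "\<lambda>_. borel"] rv indep law by simp
  moreover have "(\<lambda>x. \<chi> j. x j) \<in> borel_measurable (\<Pi>\<^sub>M j\<in>(UNIV::'d set). (borel :: real measure))"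
    by (simp add: borel_measurable_vec_iff)
  moreover have "(\<lambda>\<omega>. \<lambda>j\<in>UNIV. X \<omega> $ j) \<in> M \<rightarrow>\<^sub>M (\<Pi>\<^sub>M j\<in>(UNIV::'d set). (borel :: real measure))"
    using rv by (intro measurable_restrict) auto
  ultimately show ?thesis
    unfolding product_law_def by (metis (no_types, lifting) distr_distr distr_cong comp_apply restrict_UNIV vec_nth_inverse)
qed

lemma borel_measurable_if_continuous_on_open:
  fixes \<rho> :: "real \<Rightarrow> real"
  assumes "open \<Omega>" "continuous_on \<Omega> \<rho>" "\<And>x. x \<notin> \<Omega> \<Longrightarrow> \<rho> x = 0"
  shows "\<rho> \<in> borel_measurable borel"
proof -
  have "(\<lambda>x. indicator \<Omega> x *\<^sub>R \<rho> x) \<in> borel_measurable borel"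
    using assms by (intro borel_measurable_continuous_on_indicator) auto
  also have "(\<lambda>x. indicator \<Omega> x *\<^sub>R \<rho> x) = \<rho>"
    using assms(3) by (auto simp: fun_eq_iff indicator_def)
  finally show ?thesis .
qed

lemma AE_in_support:
  assumes X: "Y \<in> borel_measurable P" and law: "distr P borel Y = density lborel (\<lambda>x. ennreal (\<rho> x))"
    and \<rho>: "\<rho> \<in> borel_measurable borel" and zero: "\<And>x::real. x \<notin> \<Omega> \<Longrightarrow> \<rho> x = 0"
    and \<Omega>: "\<Omega> \<in> sets borel"
  shows "AE \<omega> in P. Y \<omega> \<in> \<Omega>"
proof -
  have "AE x in distr P borel Y. x \<in> \<Omega>"
    unfolding law using \<rho> zero by (subst AE_density) (auto intro!: AE_I2, force)
  then show ?thesis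
    using AE_distr_iff[OF X, of "\<lambda>x. x \<in> \<Omega>"] \<Omega> by simp
qed

lemma
  fixes h :: "'a::topological_space \<Rightarrow> 'b::{banach, second_countable_topology}"
  assumes X: "X \<in> borel_measurable P" and h: "h \<in> borel_measurable borel"
    and D: "D \<in> sets borel" and AE: "AE \<omega> in P. X \<omega> \<in> D"
  shows set_integrable_distr_iff_full: "set_integrable (distr P borel X) D h \<longleftrightarrow> integrable P (\<lambda>\<omega>. h (X \<omega>))"
    and set_lebesgue_integral_distr_full: "(LINT x:D|distr P borel X. h x) = (\<integral>\<omega>. h (X \<omega>) \<partial>P)"
proof -
  note [measurable] = X h D
  have ind: "AE \<omega> in P. indicator D (X \<omega>) *\<^sub>R h (X \<omega>) = h (X \<omega>)"
    using AE by eventually_elim simp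
  have m: "(\<lambda>x. indicator D x *\<^sub>R h x) \<in> borel_measurable borel" by measurable
  have m1: "(\<lambda>\<omega>. indicator D (X \<omega>) *\<^sub>R h (X \<omega>)) \<in> borel_measurable P"
    and m2: "(\<lambda>\<omega>. h (X \<omega>)) \<in> borel_measurable P" by measurable
  show "set_integrable (distr P borel X) D h \<longleftrightarrow> integrable P (\<lambda>\<omega>. h (X \<omega>))"
    unfolding set_integrable_def
    by (subst integrable_distr_eq[OF X m]) (rule integrable_cong_AE[OF m1 m2 ind])
  show "(LINT x:D|distr P borel X. h x) = (\<integral>\<omega>. h (X \<omega>) \<partial>P)"
    unfolding set_lebesgue_integral_def
    by (subst integral_distr[OF X m]) (rule integral_cong_AE[OF m1 m2 ind])
qed

section \<open>The sample covariance\<close>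

lemma (in prob_space) expectation_norm_deviation:
  fixes Y :: "'a \<Rightarrow> 'b::euclidean_space"
  assumes "integrable M Y" "integrable M (\<lambda>\<omega>. (norm (Y \<omega>))\<^sup>2)"
  shows "integrable M (\<lambda>\<omega>. (norm (Y \<omega> - expectation Y))\<^sup>2)"
    and "expectation (\<lambda>\<omega>. (norm (Y \<omega> - expectation Y))\<^sup>2)
      = expectation (\<lambda>\<omega>. (norm (Y \<omega>))\<^sup>2) - (norm (expectation Y))\<^sup>2"
proof -
  have eq: "(norm (Y \<omega> - expectation Y))\<^sup>2
      = (norm (Y \<omega>))\<^sup>2 - 2 * (Y \<omega> \<bullet> expectation Y) + (norm (expectation Y))\<^sup>2" for \<omega>
    by (simp add: power2_norm_eq_inner inner_diff inner_commute)
  show "integrable M (\<lambda>\<omega>. (norm (Y \<omega> - expectation Y))\<^sup>2)"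
    unfolding eq using assms by auto
  show "expectation (\<lambda>\<omega>. (norm (Y \<omega> - expectation Y))\<^sup>2)
      = expectation (\<lambda>\<omega>. (norm (Y \<omega>))\<^sup>2) - (norm (expectation Y))\<^sup>2"
    unfolding eq using assms by (simp add: prob_space power2_norm_eq_inner)
qed

lemma (in prob_space) square_integrable_norm_imp_integrable:
  fixes Y :: "'a \<Rightarrow> 'b::euclidean_space"
  assumes "Y \<in> borel_measurable M" "integrable M (\<lambda>\<omega>. (norm (Y \<omega>))\<^sup>2)"
  shows "integrable M Y"
  using square_integrable_imp_integrable[of "\<lambda>\<omega>. norm (Y \<omega>)"] assms
  by (simp add: integrable_norm_iff)

lemma (in prob_space) trace_variance_matrix:
  fixes f :: "real^'d \<Rightarrow> real^'n"
  assumes X: "X \<in> borel_measurable M" and D: "D \<in> sets borel" and AE: "AE \<omega> in M. X \<omega> \<in> D"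
    and f: "f \<in> borel_measurable borel" and sq: "integrable M (\<lambda>\<omega>. (norm (f (X \<omega>)))\<^sup>2)"
  shows "trace (variance_matrix (distr M borel X) D f)
    = expectation (\<lambda>\<omega>. (norm (f (X \<omega>)))\<^sup>2) - (norm (expectation (\<lambda>\<omega>. f (X \<omega>))))\<^sup>2"
proof -
  have ff: "(\<lambda>x. outer (f x) (f x)) \<in> borel_measurable borel"
    using f by (intro borel_measurable_outer)
  have "integrable M (\<lambda>\<omega>. outer (f (X \<omega>)) (f (X \<omega>)))"
    using measurable_compose[OF X ff]
    by (intro Bochner_Integration.integrable_bound[OF sq]) (auto simp: norm_outer power2_eq_square)
  from integral_bounded_linear[OF bounded_linear_trace this]
  show ?thesis
    unfolding variance_matrix_def set_lebesgue_integral_distr_full[OF X f D AE]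
      set_lebesgue_integral_distr_full[OF X ff D AE]
    by (simp add: trace_sub trace_outer power2_norm_eq_inner)
qed

lemma (in prob_space) trace_sample_covariance_consistent:
  fixes f :: "real^'d \<Rightarrow> real^'n"
  assumes T: "iid_sample M X T" and X: "X \<in> borel_measurable M"
    and f: "f \<in> borel_measurable borel" and sq: "integrable M (\<lambda>\<omega>. (norm (f (X \<omega>)))\<^sup>2)"
  shows "filterlim_in_prob M (\<lambda>m \<omega>. trace (sample_covariance m (\<lambda>i. f (T i \<omega>))))
    (nhds (expectation (\<lambda>\<omega>. (norm (f (X \<omega>)))\<^sup>2) - (norm (expectation (\<lambda>\<omega>. f (X \<omega>))))\<^sup>2))"
proof -
  let ?A = "expectation (\<lambda>\<omega>. (norm (f (X \<omega>)))\<^sup>2)" and ?E = "expectation (\<lambda>\<omega>. f (X \<omega>))"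
  have A: "filterlim_in_prob M (\<lambda>m \<omega>. (1 / real m) *\<^sub>R (\<Sum>i=1..m. (norm (f (T i \<omega>)))\<^sup>2)) (nhds ?A)"
    using f sq by (intro weak_law_of_large_numbers[OF T X]) auto
  have E: "filterlim_in_prob M (\<lambda>m \<omega>. sample_mean m (\<lambda>i. f (T i \<omega>))) (nhds ?E)"
    unfolding sample_mean_def
    using square_integrable_norm_imp_integrable[OF measurable_compose[OF X f] sq]
    by (intro weak_law_of_large_numbers[OF T X] f)
  have AE: "filterlim_in_prob M (\<lambda>m \<omega>. (1 / real m) *\<^sub>R (\<Sum>i=1..m. (norm (f (T i \<omega>)))\<^sup>2)
      - (norm (sample_mean m (\<lambda>i. f (T i \<omega>))))\<^sup>2) (nhds (?A - (norm ?E)\<^sup>2))"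
    by (rule tendsto_in_prob_compose2[OF A E, where h = "\<lambda>a e. a - (norm e)\<^sup>2"])
       (intro tendsto_intros tendsto_fst_nhds tendsto_snd_nhds)
  have "(\<lambda>m. real m / (real m - 1)) \<longlonglongrightarrow> 1" by real_asymp
  then have "filterlim_in_prob M (\<lambda>m \<omega>. real m / (real m - 1)) (nhds 1)"
    by (rule filterlim_in_prob_deterministic)
  from tendsto_in_prob_compose2[OF this AE, where h = "(*)", OF tendsto_mult[OF tendsto_fst_nhds tendsto_snd_nhds]]
  show ?thesis
    unfolding trace_sample_covariance by simp
qed

text \<open>If the variance of \<open>f (X)\<close> has trace \<open>0\<close>, then \<open>\<parallel>f (X) - E (f (X))\<parallel>\<^sup>2\<close> has expectation \<open>0\<close>, so
  \<open>f\<close> takes one and the same value at almost all sample points.\<close>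
lemma (in prob_space) trace_sample_covariance_AE_zero:
  fixes f :: "real^'d \<Rightarrow> real^'n"
  assumes T: "iid_sample M X T" and X: "X \<in> borel_measurable M"
    and f: "f \<in> borel_measurable borel" and sq: "integrable M (\<lambda>\<omega>. (norm (f (X \<omega>)))\<^sup>2)"
    and zero: "expectation (\<lambda>\<omega>. (norm (f (X \<omega>)))\<^sup>2) - (norm (expectation (\<lambda>\<omega>. f (X \<omega>))))\<^sup>2 = 0"
  shows "AE \<omega> in M. trace (sample_covariance m (\<lambda>i. f (T i \<omega>))) = 0"
proof -
  let ?E = "expectation (\<lambda>\<omega>. f (X \<omega>))"
  note int = square_integrable_norm_imp_integrable[OF measurable_compose[OF X f] sq]
  note dev = expectation_norm_deviation[OF int sq]
  have m: "{x. f x = ?E} \<in> sets borel" using f by measurable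
  have "AE \<omega> in M. (norm (f (X \<omega>) - ?E))\<^sup>2 = 0"
    using integral_nonneg_eq_0_iff_AE[OF dev(1)] dev(2) zero by simp
  then have "AE x in distr M borel X. f x = ?E"
    using m by (subst AE_distr_iff[OF X]) auto
  then have "AE x in distr M borel (T i). f x = ?E" if "i \<in> {1..m}" for i
  proof -
    have "distr M borel (T i) = distr M borel X" using T that unfolding iid_sample_def by auto
    then show ?thesis using \<open>AE x in distr M borel X. f x = ?E\<close> by (simp only:)
  qed
  then have "AE \<omega> in M. f (T i \<omega>) = ?E" if "i \<in> {1..m}" for i
    using AE_distr_iff[OF iid_sample_measurable[OF T], of i "\<lambda>x. f x = ?E"] m that by simp
  then have "AE \<omega> in M. \<forall>i\<in>{1..m}. f (T i \<omega>) = ?E"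
    by (subst AE_finite_all) auto
  then show ?thesis
  proof eventually_elim
    case (elim \<omega>)
    then have "(\<Sum>i=1..m. f (T i \<omega>)) = real m *\<^sub>R ?E"
      and "(\<Sum>i=1..m. (norm (f (T i \<omega>)))\<^sup>2) = real m * (norm ?E)\<^sup>2" by (simp_all add: sum_constant_scaleR del: sum_constant)
    then show ?case
      unfolding trace_sample_covariance sample_mean_def by simp
  qed
qed

section \<open>The weighted derivatives\<close>

lemma borel_measurable_cdf:
  assumes "finite_borel_measure \<mu>"
  shows "cdf \<mu> \<in> borel_measurable borel"
  using finite_borel_measure.cdf_nondecreasing[OF assms] by (intro borel_measurable_mono monoI)

lemma borel_measurable_NUB_integrand:
  assumes \<mu>: "\<And>k. real_distribution (\<mu> k)" and \<rho> [measurable]: "\<And>k. \<rho> k \<in> borel_measurable borel"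
    and df [measurable]: "cross_partial u f \<in> borel_measurable borel"
  shows "NUB_integrand \<mu> \<rho> u f \<in> borel_measurable borel"
proof -
  have [measurable]: "cdf (\<mu> k) \<in> borel_measurable borel" for k
    by (intro borel_measurable_cdf real_distribution.finite_borel_measure_M \<mu>)
  have [measurable]: "(\<lambda>x::(real, 'd::{finite,linorder}) vec. x $ k) \<in> borel_measurable borel" for k
    by (intro borel_measurable_continuous_onI continuous_intros)
  show ?thesis
    unfolding NUB_integrand_def [abs_def]
    by (intro borel_measurable_scaleR borel_measurable_outer df) measurable
qed

text \<open>The integrand is a nonnegative weight times a rank-one matrix \<open>v v\<^sup>T\<close>, whose trace and
  Frobenius norm are both \<open>\<parallel>v\<parallel>\<^sup>2\<close>. The scalar trace therefore decides whether the matrix-valued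
  integral exists, which is what reduces the divergent case to real random variables.\<close>

lemma trace_NUB_integrand_eq_norm:
  assumes \<mu>: "\<And>k. real_distribution (\<mu> k)"
  shows "trace (NUB_integrand \<mu> \<rho> u f x) = norm (NUB_integrand \<mu> \<rho> u f x)"
proof -
  have "0 \<le> (\<Prod>k\<in>u. cdf (\<mu> k) (x $ k) * (1 - cdf (\<mu> k) (x $ k)) / (\<rho> k (x $ k))\<^sup>2)"
  proof (rule prod_nonneg)
    fix k
    interpret real_distribution "\<mu> k" by (rule \<mu>)
    show "0 \<le> cdf (\<mu> k) (x $ k) * (1 - cdf (\<mu> k) (x $ k)) / (\<rho> k (x $ k))\<^sup>2"
      using cdf_nonneg[of "x $ k"] cdf_bounded_prob[of "x $ k"] by simp
  qed
  then show ?thesis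
    unfolding NUB_integrand_def
    by (simp add: trace_scaleR trace_outer norm_outer power2_norm_eq_inner flip: power2_eq_square)
qed

section \<open>Consistency of the proxy-measures\<close>

theorem theorem4p2:
  fixes P :: "'w measure"
    and X :: "'w \<Rightarrow> (real, 'd::{finite,linorder}) vec"
    and S T :: "nat \<Rightarrow> 'w \<Rightarrow> (real, 'd) vec"
    and N :: "nat \<Rightarrow> nat"
    and \<mu> :: "'d \<Rightarrow> real measure"
    and \<rho> :: "'d \<Rightarrow> real \<Rightarrow> real"
    and \<Omega> :: "'d \<Rightarrow> real set"
    and f :: "(real, 'd) vec \<Rightarrow> real^'n"
    and u :: "'d set"
    and \<Sigma> :: "real^'n^'n"
    and \<Sigma>hat :: "nat \<Rightarrow> 'w \<Rightarrow> real^'n^'n"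
  assumes prob: "prob_space P"
    and X_meas: "X \<in> borel_measurable P"
    and X_indep: "prob_space.indep_vars P (\<lambda>_. borel) (\<lambda>j \<omega>. X \<omega> $ j) UNIV"
    and X_law: "\<And>j. distr P borel (\<lambda>\<omega>. X \<omega> $ j) = \<mu> j"
    and density: "\<And>j. \<mu> j = density lborel (\<lambda>x. ennreal (\<rho> j x))"
    and support_open: "\<And>j. open (\<Omega> j)"
    and density_cont: "\<And>j. continuous_on (\<Omega> j) (\<rho> j)"
    and density_pos: "\<And>j x. x \<in> \<Omega> j \<Longrightarrow> \<rho> j x > 0"
    and density_zero: "\<And>j x. x \<notin> \<Omega> j \<Longrightarrow> \<rho> j x = 0"
    and f_meas: "\<And>i. (\<lambda>x. f x $ i) \<in> borel_measurable borel"
    and f_diff: "\<And>v. differentiable_wrt v f"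
    and f_sq: "integrable P (\<lambda>\<omega>. (norm (f (X \<omega>)))\<^sup>2)"
    and df_meas: "\<And>v. cross_partial v f \<in> borel_measurable borel"
    and df_sq: "\<And>v. integrable P (\<lambda>\<omega>. (norm (cross_partial v f (X \<omega>)))\<^sup>2)"
    and u_nonempty: "u \<noteq> {}"
    and sample: "iid_sample P X S"
    and \<Sigma>: "\<Sigma> = variance_matrix (product_law \<mu>) (box_of \<Omega>) f"
    and cov_sample: "iid_sample P X T"
    and cov_sample_size: "filterlim N at_top sequentially"
    and \<Sigma>hat: "\<And>m \<omega>. \<Sigma>hat m \<omega> = sample_covariance (N m) (\<lambda>i. f (T i \<omega>))"
  shows
    "(NUB_finite \<mu> \<rho> \<Omega> u f \<longrightarrow>
        tendsto_in_prob P (\<lambda>m \<omega>. UB_F_estimator \<mu> \<rho> u f m (\<lambda>i. S i \<omega>) (\<Sigma>hat m \<omega>))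
          (trace (NUB_sup \<mu> \<rho> \<Omega> u f) / trace \<Sigma>) \<and>
        tendsto_in_prob P (\<lambda>m \<omega>. UB_l2_estimator \<mu> \<rho> u f m (\<lambda>i. S i \<omega>) (\<Sigma>hat m \<omega>))
          (frobenius_norm (NUB_sup \<mu> \<rho> \<Omega> u f) / (real CARD('n) * trace \<Sigma>))) \<and>
     (\<not> NUB_finite \<mu> \<rho> \<Omega> u f \<and> trace \<Sigma> > 0 \<longrightarrow>
        tendsto_infinity_in_prob P
          (\<lambda>m \<omega>. UB_F_estimator \<mu> \<rho> u f m (\<lambda>i. S i \<omega>) (\<Sigma>hat m \<omega>)) \<and>
        tendsto_infinity_in_prob P
          (\<lambda>m \<omega>. UB_l2_estimator \<mu> \<rho> u f m (\<lambda>i. S i \<omega>) (\<Sigma>hat m \<omega>)))"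
proof -
  \<comment> \<open>Restated because the interpretation below hides the name \<open>density_zero\<close>.\<close>
  have outside: "\<And>j x. x \<notin> \<Omega> j \<Longrightarrow> \<rho> j x = 0" by (rule density_zero)
  interpret prob_space P by (rule prob)
  let ?G = "NUB_integrand \<mu> \<rho> u f" and ?D = "box_of \<Omega>" and ?n = "real CARD('n)"
  let ?M = "\<lambda>m \<omega>. NUB_estimator \<mu> \<rho> u f m (\<lambda>i. S i \<omega>)"
  have X_comp: "(\<lambda>\<omega>. X \<omega> $ j) \<in> borel_measurable P" for j
    using X_meas by (simp add: borel_measurable_vec_iff)
  have law: "product_law \<mu> = distr P borel X"
    by (rule product_law_eq_distr[OF X_indep X_law])
  have \<mu>: "real_distribution (\<mu> j)" for j
    using real_distribution_distr[OF X_comp] by (simp only: X_law)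
  have \<rho>: "\<rho> j \<in> borel_measurable borel" for j
    using support_open density_cont outside by (rule borel_measurable_if_continuous_on_open)
  have f: "f \<in> borel_measurable borel"
    using f_meas by (simp add: borel_measurable_vec_iff)
  have "open ?D"
    unfolding box_of_def using support_open by (simp add: open_vector_box)
  then have D: "?D \<in> sets borel" by simp
  have "AE \<omega> in P. X \<omega> $ j \<in> \<Omega> j" for j
    using support_open outside
    by (intro AE_in_support[OF X_comp trans[OF X_law density] \<rho>]) auto
  then have X_box: "AE \<omega> in P. X \<omega> \<in> ?D"
    unfolding box_of_def by (simp add: AE_all_countable)
  have G: "?G \<in> borel_measurable borel"
    by (rule borel_measurable_NUB_integrand[OF \<mu> \<rho> df_meas])
  have trace_G: "trace (?G x) = norm (?G x)" for x
    by (rule trace_NUB_integrand_eq_norm[OF \<mu>])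
  have finite_iff: "NUB_finite \<mu> \<rho> \<Omega> u f \<longleftrightarrow> integrable P (\<lambda>\<omega>. ?G (X \<omega>))"
    unfolding NUB_finite_def law by (rule set_integrable_distr_iff_full[OF X_meas G D X_box])
  have estimator: "?M m \<omega> = (1 / 2 ^ card u) *\<^sub>R ((1 / real m) *\<^sub>R (\<Sum>i=1..m. ?G (S i \<omega>)))" for m \<omega>
    by (simp add: NUB_estimator_def)
  have trace_\<Sigma>: "trace \<Sigma>
      = expectation (\<lambda>\<omega>. (norm (f (X \<omega>)))\<^sup>2) - (norm (expectation (\<lambda>\<omega>. f (X \<omega>))))\<^sup>2"
    unfolding \<Sigma> law by (rule trace_variance_matrix[OF X_meas D X_box f f_sq])
  have C: "filterlim_in_prob P (\<lambda>m \<omega>. trace (\<Sigma>hat m \<omega>)) (nhds (trace \<Sigma>))"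
    unfolding \<Sigma>hat trace_\<Sigma>
    by (rule filterlim_in_prob_subseq[OF trace_sample_covariance_consistent[OF cov_sample X_meas f f_sq] cov_sample_size])
  have nC: "filterlim_in_prob P (\<lambda>m \<omega>. ?n * trace (\<Sigma>hat m \<omega>)) (nhds (?n * trace \<Sigma>))"
    by (rule filterlim_in_prob_compose[OF C]) (intro tendsto_intros filterlim_ident)
  have C_zero: "AE \<omega> in P. trace (\<Sigma>hat m \<omega>) = 0" if "trace \<Sigma> = 0" for m
    using that trace_sample_covariance_AE_zero[OF cov_sample X_meas f f_sq] unfolding \<Sigma>hat trace_\<Sigma> by blast
  show ?thesis
  proof (intro conjI impI)
    assume "NUB_finite \<mu> \<rho> \<Omega> u f"
    then have int: "integrable P (\<lambda>\<omega>. ?G (X \<omega>))" by (simp only: finite_iff)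
    have sup: "NUB_sup \<mu> \<rho> \<Omega> u f = (1 / 2 ^ card u) *\<^sub>R expectation (\<lambda>\<omega>. ?G (X \<omega>))"
      unfolding NUB_sup_def law set_lebesgue_integral_distr_full[OF X_meas G D X_box] ..
    have M: "filterlim_in_prob P ?M (nhds (NUB_sup \<mu> \<rho> \<Omega> u f))"
      unfolding estimator sup
      by (rule filterlim_in_prob_compose[OF weak_law_of_large_numbers[OF sample X_meas G int]])
         (intro tendsto_intros filterlim_ident)
    have "filterlim_in_prob P (\<lambda>m \<omega>. trace (?M m \<omega>)) (nhds (trace (NUB_sup \<mu> \<rho> \<Omega> u f)))"
      by (rule filterlim_in_prob_compose[OF M])
         (rule bounded_linear.tendsto[OF bounded_linear_trace filterlim_ident])
    then show "tendsto_in_prob P (\<lambda>m \<omega>. UB_F_estimator \<mu> \<rho> u f m (\<lambda>i. S i \<omega>) (\<Sigma>hat m \<omega>))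
        (trace (NUB_sup \<mu> \<rho> \<Omega> u f) / trace \<Sigma>)"
      unfolding UB_F_estimator_def
      by (intro tendsto_in_prob_if_filterlim tendsto_in_prob_divide C C_zero)
    have "filterlim_in_prob P (\<lambda>m \<omega>. norm (?M m \<omega>)) (nhds (norm (NUB_sup \<mu> \<rho> \<Omega> u f)))"
      by (rule filterlim_in_prob_compose[OF M]) (intro tendsto_intros filterlim_ident)
    moreover have "AE \<omega> in P. ?n * trace (\<Sigma>hat m \<omega>) = 0" if "?n * trace \<Sigma> = 0" for m
      using C_zero[of m] that by simp
    ultimately show "tendsto_in_prob P (\<lambda>m \<omega>. UB_l2_estimator \<mu> \<rho> u f m (\<lambda>i. S i \<omega>) (\<Sigma>hat m \<omega>))
        (frobenius_norm (NUB_sup \<mu> \<rho> \<Omega> u f) / (?n * trace \<Sigma>))"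
      unfolding UB_l2_estimator_def frobenius_norm_eq_norm
      by (intro tendsto_in_prob_if_filterlim tendsto_in_prob_divide nC)
  next
    assume *: "\<not> NUB_finite \<mu> \<rho> \<Omega> u f \<and> trace \<Sigma> > 0"
    have tr: "(\<lambda>x. trace (?G x)) \<in> borel_measurable borel"
      unfolding trace_G using G by measurable
    \<comment> \<open>The trace equals the norm, and a measurable function is integrable iff its norm is.\<close>
    have "\<not> integrable P (\<lambda>\<omega>. trace (?G (X \<omega>)))"
      using * measurable_compose[OF X_meas G] unfolding trace_G finite_iff
      by (simp add: integrable_norm_iff)
    then have sum: "filterlim_in_prob P (\<lambda>m \<omega>. (1 / real m) *\<^sub>R (\<Sum>i=1..m. trace (?G (S i \<omega>)))) at_top"
      by (intro weak_law_infinite_mean[OF sample X_meas tr]) (simp add: trace_G)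
    have trace_M: "trace (?M m \<omega>)
        = (1 / 2 ^ card u) * ((1 / real m) *\<^sub>R (\<Sum>i=1..m. trace (?G (S i \<omega>))))" for m \<omega>
      unfolding estimator trace_scaleR
      by (simp add: linear_sum[OF bounded_linear.linear[OF bounded_linear_trace]])
    have M: "filterlim_in_prob P (\<lambda>m \<omega>. trace (?M m \<omega>)) at_top"
      unfolding trace_M
      by (rule filterlim_in_prob_compose[OF sum])
         (intro filterlim_tendsto_pos_mult_at_top[OF tendsto_const] filterlim_ident, simp)
    then show "tendsto_infinity_in_prob P (\<lambda>m \<omega>. UB_F_estimator \<mu> \<rho> u f m (\<lambda>i. S i \<omega>) (\<Sigma>hat m \<omega>))"
      unfolding UB_F_estimator_def using *
      by (intro tendsto_infinity_in_prob_if_filterlim filterlim_in_prob_divide_at_top[OF _ C]) auto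
    have "filterlim_in_prob P (\<lambda>m \<omega>. inverse ?n * trace (?M m \<omega>)) at_top"
      by (rule filterlim_in_prob_compose[OF M])
         (intro filterlim_tendsto_pos_mult_at_top[OF tendsto_const] filterlim_ident, simp)
    then have "filterlim_in_prob P (\<lambda>m \<omega>. norm (?M m \<omega>)) at_top"
    proof (rule filterlim_in_prob_at_top_mono)
      show "inverse ?n * trace (?M m \<omega>) \<le> norm (?M m \<omega>)" for m \<omega>
        using trace_le_norm[of "?M m \<omega>"] by (simp add: field_simps)
    qed
    then show "tendsto_infinity_in_prob P (\<lambda>m \<omega>. UB_l2_estimator \<mu> \<rho> u f m (\<lambda>i. S i \<omega>) (\<Sigma>hat m \<omega>))"
      unfolding UB_l2_estimator_def frobenius_norm_eq_norm using *
      by (intro tendsto_infinity_in_prob_if_filterlim filterlim_in_prob_divide_at_top[OF _ nC]) auto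
  qed
qed

end
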